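(* Let $L_s=-\partial^2+u_s$ be an algebro-geometric Schrödinger operator with spectral curve $\Gamma_s$ and nonconstant potential $u_s$, and let $K=C\langle u_s\rangle$. Fix $P_0=(\lambda_0,\mu_0)\in\Gamma_s\setminus Z_s$. The Picard-Vessiot extension of the equation $(L_s-\lambda_0)y=0$ over $K$ is the Liouvillian extension $K\langle y_0\rangle$ of $K$ by a nonzero solution $y_0$ of $(\partial-\phi_0)y=0$.
   Context: $(\Sigma,\partial)$ is a differential field of characteristic zero whose field of constants $C$ is algebraically closed. An operator $L\in\Sigma[\partial]\setminus C[\partial]$ of order $n$ is algebro-geometric if some $P\in\Sigma[\partial]$ of order relatively prime to $n$ satisfies $[L,P]=0$. Let $L_s=-\partial^2+u_s$ with $u_s\in\Sigma\setminus C$ be algebro-geometric. Then there is a unique monic operator $A_{2s+1}$ of minimal order $2s+1$ (minimal among operators of the centralizer not in $C[L_s]$) such that the centralizer of $L_s$ in $\Sigma[\partial]$ is $C[L_s,A_{2s+1}]$ and $A_{2s+1}^2+R_{2s+1}(L_s)=0$ with $R_{2s+1}\in C[\lambda]$ of degree $2s+1$; $A_{2s+1}$ is the partner of $L_s$ and $s$ the level. $K=C\langle u_s\rangle$ is the differential subfield of $\Sigma$ generated by $C$ and $u_s$; $L_s,A_{2s+1}\in K[\partial]$. The spectral curve is $\Gamma_s=\{(\lambda,\mu)\in C^2: \mu^2+R_{2s+1}(\lambda)=0\}$ and $Z_s=\Gamma_s\cap(C\times\{0\})=\{(\lambda,0): R_{2s+1}(\lambda)=0\}$. For every $P_0=(\lambda_0,\mu_0)\in\Gamma_s$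 the greatest common right divisor of $L_s-\lambda_0$ and $A_{2s+1}-\mu_0$ in $K[\partial]$ has order one; its monic form is written $\partial-\phi_0$ with $\phi_0\in K$, and $L_s-\lambda_0=(-\partial-\phi_0)(\partial-\phi_0)$. Solutions are taken in a differential closure of $K$; $\langle\,\cdot\,\rangle$ denotes the generated differential field extension. A Picard-Vessiot extension of $K$ for $(L_s-\lambda_0)y=0$ is a differential field $K\langle y_1,y_2\rangle$ generated over $K$ by a fundamental set of solutions $\{y_1,y_2\}$, whose field of constants is that of $K$, namely $C$. *)

theory Defs
  imports "HOL-Computational_Algebra.Polynomial" "HOL-Library.Poly_Mapping"
begin

section \<open>Differential fields\<close>

class differential_field = field_char_0 +
  fixes der :: "'a \<Rightarrow> 'a"
  assumes der_add: "der (x + y) = der x + der y"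
    and der_mult: "der (x * y) = der x * y + x * der y"
begin

lemma der_0 [simp]: "der 0 = 0"
  using der_add[of 0 0] by simp

lemma der_1 [simp]: "der 1 = 0"
  using der_mult[of 1 1] by simp

end

definition constants :: "'a::differential_field set" where
  "constants = {c. der c = 0}"

definition differential_subfield :: "'a::differential_field set \<Rightarrow> bool" where
  "differential_subfield F \<longleftrightarrow> 1 \<in> F \<and> (\<forall>x\<in>F. \<forall>y\<in>F. x - y \<in> F \<and> x * y \<in> F) \<and>
     (\<forall>x\<in>F. inverse x \<in> F \<and> der x \<in> F)"

text \<open>\<open>diff_adjoin B S\<close> is the differential field \<open>B\<langle>S\<rangle>\<close>, formed inside the ambient type.\<close>

definition diff_adjoin :: "'a::differential_field set \<Rightarrow> 'a set \<Rightarrow> 'a set" where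
  "diff_adjoin B S = \<Inter>{F. differential_subfield F \<and> B \<subseteq> F \<and> S \<subseteq> F}"

definition algebraically_closed :: "'a::field set \<Rightarrow> bool" where
  "algebraically_closed F \<longleftrightarrow>
     (\<forall>p. (\<forall>i. coeff p i \<in> F) \<and> degree p > 0 \<longrightarrow> (\<exists>x\<in>F. poly p x = 0))"

definition algebraic_over :: "'a::field set \<Rightarrow> 'a \<Rightarrow> bool" where
  "algebraic_over F x \<longleftrightarrow> (\<exists>p. p \<noteq> 0 \<and> (\<forall>i. coeff p i \<in> F) \<and> poly p x = 0)"

text \<open>Only the values of \<open>\<iota>\<close> on \<open>k\<close> matter. Injectivity on a field \<open>k\<close> is automatic.\<close>

definition differential_embedding ::
    "'a::differential_field set \<Rightarrow> ('a \<Rightarrow> 'b::differential_field) \<Rightarrow> bool" where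
  "differential_embedding k \<iota> \<longleftrightarrow> \<iota> 1 = 1 \<and>
     (\<forall>x\<in>k. \<forall>y\<in>k. \<iota> (x + y) = \<iota> x + \<iota> y \<and> \<iota> (x * y) = \<iota> x * \<iota> y) \<and>
     (\<forall>x\<in>k. \<iota> (der x) = der (\<iota> x))"


section \<open>Differential operators\<close>

text \<open>
  The operator \<open>\<Sum>\<^sub>i a\<^sub>i \<partial>\<^sup>i\<close> is stored as the polynomial with coefficients \<open>a\<^sub>i\<close>; the
  product is the one determined by \<open>\<partial> a = a \<partial> + der a\<close>, of which \<open>skew_shift\<close> gives the
  left multiplication by \<open>\<partial>\<close>.
\<close>

definition skew_shift :: "'a::differential_field poly \<Rightarrow> 'a poly" where
  "skew_shift q = pCons 0 q + map_poly der q"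

definition skew_mult :: "'a::differential_field poly \<Rightarrow> 'a poly \<Rightarrow> 'a poly" where
  "skew_mult p q = (\<Sum>i\<le>degree p. smult (coeff p i) ((skew_shift ^^ i) q))"

lemma skew_shift_add: "skew_shift (p + q) = skew_shift p + skew_shift q"
  by (rule poly_eqI) (simp add: skew_shift_def coeff_map_poly coeff_pCons der_add split: nat.split)

lemma skew_shift_smult: "skew_shift (smult a p) = smult (der a) p + smult a (skew_shift p)"
  by (rule poly_eqI)
    (simp add: skew_shift_def coeff_map_poly coeff_pCons der_mult algebra_simps split: nat.split)

lemma skew_shift_pow_add: "(skew_shift ^^ i) (p + q) = (skew_shift ^^ i) p + (skew_shift ^^ i) q"
  by (induction i) (simp_all add: skew_shift_add)

lemma skew_mult_bound:
  assumes "degree p \<le> n"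
  shows "skew_mult p q = (\<Sum>i\<le>n. smult (coeff p i) ((skew_shift ^^ i) q))"
  unfolding skew_mult_def
  by (rule sum.mono_neutral_left) (use assms in \<open>auto simp: coeff_eq_0\<close>)

lemma skew_mult_add_left: "skew_mult (p + q) r = skew_mult p r + skew_mult q r"
proof -
  define n where "n = max (degree p) (degree q)"
  have "degree (p + q) \<le> n" "degree p \<le> n" "degree q \<le> n"
    by (auto simp: n_def degree_add_le)
  then show ?thesis
    by (simp add: skew_mult_bound[of _ n] smult_add_left sum.distrib)
qed

lemma skew_mult_add_right: "skew_mult p (q + r) = skew_mult p q + skew_mult p r"
  by (simp add: skew_mult_def skew_shift_pow_add smult_add_right sum.distrib)

lemma skew_mult_0_left [simp]: "skew_mult 0 q = 0"
  by (simp add: skew_mult_def)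

lemma smult_sum_distrib: "smult a (sum f A) = (\<Sum>x\<in>A. smult a (f x))"
  by (induction A rule: infinite_finite_induct) (simp_all add: smult_add_right)

lemma skew_mult_smult_left: "skew_mult (smult a p) q = smult a (skew_mult p q)"
  by (simp add: skew_mult_bound[of _ "degree p"] degree_smult_le smult_sum_distrib)

lemma skew_mult_sum_left: "skew_mult (sum f A) q = (\<Sum>x\<in>A. skew_mult (f x) q)"
  by (induction A rule: infinite_finite_induct) (simp_all add: skew_mult_add_left)

lemma skew_mult_pCons: "skew_mult (pCons a p) q = smult a q + skew_mult p (skew_shift q)"
proof -
  have "skew_mult (pCons a p) q =
      (\<Sum>i\<le>Suc (degree p). smult (coeff (pCons a p) i) ((skew_shift ^^ i) q))"
    by (rule skew_mult_bound) (simp add: degree_pCons_le)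
  also have "\<dots> = smult a q + skew_mult p (skew_shift q)"
    by (simp only: sum.atMost_Suc_shift skew_mult_def) (simp del: funpow.simps add: funpow_Suc_right)
  finally show ?thesis .
qed

lemma skew_mult_skew_shift: "skew_mult (skew_shift p) q = skew_shift (skew_mult p q)"
proof (induction p arbitrary: q)
  case 0
  show ?case by (simp add: skew_shift_def)
next
  case (pCons a p)
  have "skew_shift (pCons a p) = pCons (der a) (skew_shift p + [:a:])"
    by (rule poly_eqI) (simp add: skew_shift_def coeff_map_poly coeff_pCons split: nat.split)
  then show ?case
    by (simp add: skew_mult_pCons skew_mult_add_left pCons.IH skew_shift_add skew_shift_smult)
qed

lemma skew_mult_assoc: "skew_mult (skew_mult p q) r = skew_mult p (skew_mult q r)"
proof -
  have "skew_mult ((skew_shift ^^ i) q) r = (skew_shift ^^ i) (skew_mult q r)" for i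
    by (induction i) (simp_all add: skew_mult_skew_shift)
  then show ?thesis
    by (simp add: skew_mult_def[of p] skew_mult_sum_left skew_mult_smult_left)
qed

lemma skew_mult_1_left: "skew_mult 1 q = q"
  by (simp add: skew_mult_def)

lemma skew_mult_1_right: "skew_mult p 1 = p"
proof -
  have "(skew_shift ^^ i) (1::'a poly) = monom 1 i" for i
  proof (induction i)
    case (Suc i)
    have "map_poly der (monom 1 i) = (0::'a poly)"
      by (rule poly_eqI) (simp add: coeff_map_poly)
    with Suc show ?case by (simp add: skew_shift_def monom_Suc)
  qed simp
  then show ?thesis
    by (simp add: skew_mult_def smult_monom poly_as_sum_of_monoms)
qed

typedef (overloaded) 'a dop = "UNIV :: 'a::differential_field poly set"
  morphisms dop_symbol Dop ..

setup_lifting type_definition_dop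

instantiation dop :: (differential_field) ring_1
begin

lift_definition zero_dop :: "'a dop" is 0 .
lift_definition one_dop :: "'a dop" is 1 .
lift_definition plus_dop :: "'a dop \<Rightarrow> 'a dop \<Rightarrow> 'a dop" is "(+)" .
lift_definition minus_dop :: "'a dop \<Rightarrow> 'a dop \<Rightarrow> 'a dop" is "(-)" .
lift_definition uminus_dop :: "'a dop \<Rightarrow> 'a dop" is uminus .
lift_definition times_dop :: "'a dop \<Rightarrow> 'a dop \<Rightarrow> 'a dop" is skew_mult .

instance
  by standard (transfer; simp add: skew_mult_assoc skew_mult_1_left skew_mult_1_right
    skew_mult_add_left skew_mult_add_right)+

end

lift_definition dop_coeff :: "'a::differential_field dop \<Rightarrow> nat \<Rightarrow> 'a" is coeff .
lift_definition dop_order :: "'a::differential_field dop \<Rightarrow> nat" is degree .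
lift_definition dop_const :: "'a::differential_field \<Rightarrow> 'a dop" is "\<lambda>a. [:a:]" .
lift_definition dop_D :: "'a::differential_field dop" (\<open>\<partial>\<close>) is "[:0, 1:]" .
lift_definition map_dop ::
    "('a::differential_field \<Rightarrow> 'b::differential_field) \<Rightarrow> 'a dop \<Rightarrow> 'b dop" is map_poly .

lemma dop_D_times_const: "\<partial> * dop_const a = dop_const a * \<partial> + dop_const (der a)"
  by transfer (simp add: skew_mult_pCons skew_shift_def map_poly_pCons)

definition dop_apply :: "'a::differential_field dop \<Rightarrow> 'a \<Rightarrow> 'a" where
  "dop_apply L y = (\<Sum>i\<le>dop_order L. dop_coeff L i * (der ^^ i) y)"

definition dop_over :: "'a::differential_field set \<Rightarrow> 'a dop set" where
  "dop_over k = {L. \<forall>i. dop_coeff L i \<in> k}"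

definition monic_dop :: "'a::differential_field dop \<Rightarrow> bool" where
  "monic_dop L \<longleftrightarrow> dop_coeff L (dop_order L) = 1"

definition right_divides_over ::
    "'a::differential_field set \<Rightarrow> 'a dop \<Rightarrow> 'a dop \<Rightarrow> bool" where
  "right_divides_over k G P \<longleftrightarrow> (\<exists>Q\<in>dop_over k. P = Q * G)"

definition is_gcrd_over ::
    "'a::differential_field set \<Rightarrow> 'a dop \<Rightarrow> 'a dop \<Rightarrow> 'a dop \<Rightarrow> bool" where
  "is_gcrd_over k G P Q \<longleftrightarrow> G \<in> dop_over k \<and>
     right_divides_over k G P \<and> right_divides_over k G Q \<and>
     (\<forall>H\<in>dop_over k. right_divides_over k H P \<and> right_divides_over k H Q \<longrightarrow>
        right_divides_over k H G)"


section \<open>Algebro-geometric Schroedinger operators and their spectral curves\<close>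

definition centralizer :: "'a::differential_field dop \<Rightarrow> 'a dop set" where
  "centralizer L = {P. L * P - P * L = 0}"

definition algebro_geometric :: "'a::differential_field dop \<Rightarrow> bool" where
  "algebro_geometric L \<longleftrightarrow> L \<notin> dop_over constants \<and>
     (\<exists>P. coprime (dop_order P) (dop_order L) \<and> L * P - P * L = 0)"

definition schrodinger :: "'a::differential_field \<Rightarrow> 'a dop" where
  "schrodinger u = - (\<partial> ^ 2) + dop_const u"

definition potential_field :: "'a::differential_field \<Rightarrow> 'a set" where
  "potential_field u = diff_adjoin constants {u}"

text \<open>\<open>const_algebra X\<close> is the algebra \<open>C[X]\<close> over the constants \<open>C\<close> generated by \<open>X\<close>.\<close>

inductive_set const_algebra :: "'a::differential_field dop set \<Rightarrow> 'a dop set"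
  for X where
  const: "c \<in> constants \<Longrightarrow> dop_const c \<in> const_algebra X"
| gen: "P \<in> X \<Longrightarrow> P \<in> const_algebra X"
| add: "P \<in> const_algebra X \<Longrightarrow> Q \<in> const_algebra X \<Longrightarrow> P + Q \<in> const_algebra X"
| mult: "P \<in> const_algebra X \<Longrightarrow> Q \<in> const_algebra X \<Longrightarrow> P * Q \<in> const_algebra X"

definition dop_poly :: "'a::differential_field poly \<Rightarrow> 'a dop \<Rightarrow> 'a dop" where
  "dop_poly R L = (\<Sum>i\<le>degree R. dop_const (coeff R i) * L ^ i)"

text \<open>
  \<open>is_partner L s A R\<close>: \<open>A\<close> is the partner of \<open>L\<close>, \<open>s\<close> is the level, and \<open>R\<close> is the
  polynomial \<open>R\<^bsub>2s+1\<^esub>\<close>. The last equation is what singles out \<open>A\<close> among the monic elements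
  of minimal order, which are the \<open>A + p(L)\<close> with \<open>deg p \<le> s\<close>.
\<close>

definition is_partner ::
    "'a::differential_field dop \<Rightarrow> nat \<Rightarrow> 'a dop \<Rightarrow> 'a poly \<Rightarrow> bool" where
  "is_partner L s A R \<longleftrightarrow>
     monic_dop A \<and> dop_order A = 2 * s + 1 \<and>
     A \<in> centralizer L - const_algebra {L} \<and>
     (\<forall>B\<in>centralizer L - const_algebra {L}. dop_order A \<le> dop_order B) \<and>
     centralizer L = const_algebra {L, A} \<and>
     (\<forall>i. coeff R i \<in> constants) \<and> degree R = 2 * s + 1 \<and>
     A ^ 2 + dop_poly R L = 0"

definition spectral_curve :: "'a::differential_field poly \<Rightarrow> ('a \<times> 'a) set" where
  "spectral_curve R = {(l, \<mu>). l \<in> constants \<and> \<mu> \<in> constants \<and> \<mu> ^ 2 + poly R l = 0}"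

definition spectral_zeros :: "'a::differential_field poly \<Rightarrow> ('a \<times> 'a) set" where
  "spectral_zeros R = spectral_curve R \<inter> (constants \<times> {0})"


section \<open>Differential closures\<close>

text \<open>
  Differential polynomials are ordinary polynomials, with coefficients in \<open>'a\<close>, in the
  derivatives of the unknowns. With one unknown \<open>y\<close> the variable \<open>i\<close> stands for the \<open>i\<close>-th
  derivative of \<open>y\<close>; with unknowns \<open>y\<^sub>0, \<dots>, y\<^bsub>n-1\<^esub>\<close> the variable \<open>(j, i)\<close> stands for the
  \<open>i\<close>-th derivative of \<open>y\<^sub>j\<close>.
\<close>

definition mpoly_vars :: "(('v \<Rightarrow>\<^sub>0 nat) \<Rightarrow>\<^sub>0 'a::comm_ring_1) \<Rightarrow> 'v set" where
  "mpoly_vars f = (\<Union>m\<in>Poly_Mapping.keys f. Poly_Mapping.keys m)"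

definition mpoly_eval :: "('v \<Rightarrow> 'a) \<Rightarrow> (('v \<Rightarrow>\<^sub>0 nat) \<Rightarrow>\<^sub>0 'a::comm_ring_1) \<Rightarrow> 'a" where
  "mpoly_eval x f = (\<Sum>m\<in>Poly_Mapping.keys f. Poly_Mapping.lookup f m *
     (\<Prod>v\<in>Poly_Mapping.keys m. x v ^ Poly_Mapping.lookup m v))"

definition jet :: "'a::differential_field \<Rightarrow> nat \<Rightarrow> 'a" where
  "jet y i = (der ^^ i) y"

definition jets :: "(nat \<Rightarrow> 'a::differential_field) \<Rightarrow> nat \<times> nat \<Rightarrow> 'a" where
  "jets y = (\<lambda>(j, i). jet (y j) i)"

text \<open>
  Blum's axioms: \<open>f(y) = 0 \<noteq> g(y)\<close> is solvable whenever \<open>g \<noteq> 0\<close> and the order of \<open>g\<close> is less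
  than that of \<open>f\<close>. Elements of the field have order less than \<open>0\<close>, so that the case of \<open>f\<close>
  of order \<open>0\<close> says that the field is algebraically closed.
\<close>

definition differentially_closed :: "'u::differential_field itself \<Rightarrow> bool" where
  "differentially_closed _ \<longleftrightarrow>
     (\<forall>(f :: (nat \<Rightarrow>\<^sub>0 nat) \<Rightarrow>\<^sub>0 'u) g.
        g \<noteq> 0 \<and> (\<exists>n\<in>mpoly_vars f. \<forall>i\<in>mpoly_vars g. i < n) \<longrightarrow>
        (\<exists>y. mpoly_eval (jet y) f = 0 \<and> mpoly_eval (jet y) g \<noteq> 0))"

definition dpolys :: "'a::comm_ring_1 set \<Rightarrow> nat \<Rightarrow> ((nat \<times> nat \<Rightarrow>\<^sub>0 nat) \<Rightarrow>\<^sub>0 'a) set" where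
  "dpolys k n = {f. mpoly_vars f \<subseteq> {..<n} \<times> UNIV \<and> (\<forall>m. Poly_Mapping.lookup f m \<in> k)}"

text \<open>
  Kolchin's notion: the tuple \<open>\<eta>\<^sub>0, \<dots>, \<eta>\<^bsub>n-1\<^esub>\<close> is constrained over \<open>k\<close> if some \<open>B\<close> with
  \<open>B(\<eta>) \<noteq> 0\<close> vanishes at every non-generic differential specialization \<open>\<zeta>\<close> of \<open>\<eta>\<close> over \<open>k\<close>.
  It is used only in a differentially closed field, which has enough points to detect all
  such specializations; there it says that the type of \<open>\<eta>\<close> over \<open>k\<close> is isolated.
\<close>

definition constrained :: "'u::differential_field set \<Rightarrow> nat \<Rightarrow> (nat \<Rightarrow> 'u) \<Rightarrow> bool" where
  "constrained k n \<eta> \<longleftrightarrow>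
     (\<exists>B\<in>dpolys k n. mpoly_eval (jets \<eta>) B \<noteq> 0 \<and>
        (\<forall>\<zeta>. mpoly_eval (jets \<zeta>) B \<noteq> 0 \<and>
             (\<forall>f\<in>dpolys k n. mpoly_eval (jets \<eta>) f = 0 \<longrightarrow> mpoly_eval (jets \<zeta>) f = 0) \<longrightarrow>
             (\<forall>f\<in>dpolys k n. mpoly_eval (jets \<zeta>) f = 0 \<longrightarrow> mpoly_eval (jets \<eta>) f = 0)))"

text \<open>
  The type \<open>'u\<close> is a differential closure of \<open>k\<close> by way of \<open>\<iota>\<close>: a differentially closed
  extension all of whose finite tuples are constrained. A differential closure in the sense of
  the universal property (an extension embedding over \<open>k\<close> into each differentially closed one)
  always has these two properties.
\<close>

definition differential_closure ::
    "'a::differential_field set \<Rightarrow> ('a \<Rightarrow> 'u::differential_field) \<Rightarrow> bool" where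
  "differential_closure k \<iota> \<longleftrightarrow>
     differential_embedding k \<iota> \<and> differentially_closed TYPE('u) \<and>
     (\<forall>n \<eta>. constrained (\<iota> ` k) n \<eta>)"


section \<open>Picard-Vessiot and Liouvillian extensions\<close>

text \<open>
  Linear independence over the constants does not depend on the differential field whose
  constants are meant, so those of the whole ambient field are used.
\<close>

definition fundamental_set :: "'u::differential_field dop \<Rightarrow> 'u set \<Rightarrow> bool" where
  "fundamental_set L Y \<longleftrightarrow> finite Y \<and> card Y = dop_order L \<and> (\<forall>y\<in>Y. dop_apply L y = 0) \<and>
     (\<forall>c. (\<forall>y\<in>Y. c y \<in> constants) \<and> (\<Sum>y\<in>Y. c y * y) = 0 \<longrightarrow> (\<forall>y\<in>Y. c y = 0))"

definition picard_vessiot :: "'u::differential_field set \<Rightarrow> 'u dop \<Rightarrow> 'u set \<Rightarrow> bool" where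
  "picard_vessiot k L F \<longleftrightarrow>
     (\<exists>Y. fundamental_set L Y \<and> F = diff_adjoin k Y) \<and> F \<inter> constants = k \<inter> constants"

inductive liouvillian :: "'u::differential_field set \<Rightarrow> 'u set \<Rightarrow> bool"
  for k where
  base: "differential_subfield k \<Longrightarrow> liouvillian k k"
| algebraic: "liouvillian k F \<Longrightarrow> algebraic_over F t \<Longrightarrow> liouvillian k (diff_adjoin F {t})"
| integral: "liouvillian k F \<Longrightarrow> der t \<in> F \<Longrightarrow> liouvillian k (diff_adjoin F {t})"
| exponential: "liouvillian k F \<Longrightarrow> t \<noteq> 0 \<Longrightarrow> der t / t \<in> F \<Longrightarrow> liouvillian k (diff_adjoin F {t})"

end

theory Submission
  imports Defs
begin

text \<open>
  Write \<open>M = L - l\<^sub>0\<close>, \<open>G = \<partial> - \<phi>\<^sub>0\<close> and let \<open>K\<close> be the field generated by the potential.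
  The point is that a second solution of \<open>M y = 0\<close>, independent of the solution \<open>y\<^sub>0\<close> of
  \<open>G y = 0\<close>, is \<open>a / y\<^sub>0\<close> for an \<open>a\<close> that lies already in \<open>K\<close>. The element \<open>a\<close> comes from the
  remainder of the partner modulo \<open>M\<close>: since \<open>G\<close> divides \<open>A - \<mu>\<^sub>0\<close> on the right and
  \<open>M = -(\<partial> + \<phi>\<^sub>0) G\<close>, dividing the quotient by \<open>\<partial> + \<phi>\<^sub>0\<close> gives \<open>A = \<mu>\<^sub>0 + X M + a G\<close>. Here \<open>a\<close>
  is not \<open>0\<close>, for otherwise \<open>M\<close> would be a common right divisor of order two. As \<open>A\<close> commutes
  with \<open>M\<close>, it acts on operators modulo the left ideal generated by \<open>M\<close>, and there
  \<open>A\<^sup>2 = -R(L)\<close> becomes \<open>-R(l\<^sub>0) = \<mu>\<^sub>0\<^sup>2\<close>. Comparing coefficients, this says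
  \<open>a' = 2 a \<phi>\<^sub>0 - 2 \<mu>\<^sub>0\<close> (\<open>partner_remainder_equation\<close>).

  From that equation \<open>a / y\<^sub>0\<close> is seen to solve \<open>M y = 0\<close>, and its Wronskian with \<open>y\<^sub>0\<close> is the
  constant \<open>-2 \<mu>\<^sub>0\<close>, which is where \<open>P\<^sub>0 \<notin> Z\<^sub>s\<close> enters. All solutions are therefore combinations of
  \<open>y\<^sub>0\<close> and \<open>a / y\<^sub>0\<close> with constant coefficients. If all constants of the ambient field lie in the
  base field, every fundamental set generates the same field \<open>K\<langle>y\<^sub>0\<rangle>\<close>, and this field has no new
  constants (\<open>picard_vessiot_iff_exponential\<close>).

  A differential closure has indeed no new constants: a constant which is algebraic over \<open>K\<close> has a
  minimal polynomial with constant coefficients, hence lies in \<open>C\<close>; a transcendental constant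
  specializes to infinitely many elements of \<open>C\<close>, so it is not constrained
  (\<open>constrained_constant_in_subfield\<close>).
\<close>

section \<open>Differential subfields and adjunction\<close>

lemma der_minus: "der (- x :: 'a::differential_field) = - der x"
  using der_add[of x "- x"] by (simp add: eq_neg_iff_add_eq_0 add.commute)

lemma der_diff: "der (x - y :: 'a::differential_field) = der x - der y"
  using der_add[of x "- y"] by (simp add: der_minus)

lemma
  assumes "differential_subfield F"
  shows differential_subfield_1: "1 \<in> F"
    and differential_subfield_diff: "x \<in> F \<Longrightarrow> y \<in> F \<Longrightarrow> x - y \<in> F"
    and differential_subfield_mult: "x \<in> F \<Longrightarrow> y \<in> F \<Longrightarrow> x * y \<in> F"
    and differential_subfield_inverse: "x \<in> F \<Longrightarrow> inverse x \<in> F"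
    and differential_subfield_der: "x \<in> F \<Longrightarrow> der x \<in> F"
  using assms unfolding differential_subfield_def by blast+

lemma
  assumes "differential_subfield F"
  shows differential_subfield_0: "0 \<in> F"
    and differential_subfield_uminus: "x \<in> F \<Longrightarrow> - x \<in> F"
    and differential_subfield_add: "x \<in> F \<Longrightarrow> y \<in> F \<Longrightarrow> x + y \<in> F"
    and differential_subfield_divide: "x \<in> F \<Longrightarrow> y \<in> F \<Longrightarrow> x / y \<in> F"
proof -
  note cl = differential_subfield_1[OF assms] differential_subfield_diff[OF assms]
    differential_subfield_mult[OF assms] differential_subfield_inverse[OF assms]
  show 0: "0 \<in> F" using cl(2)[OF cl(1) cl(1)] by simp
  show um: "- x \<in> F" if "x \<in> F" for x using cl(2)[OF 0 that] by simp
  show "x + y \<in> F" if "x \<in> F" "y \<in> F" using cl(2)[OF that(1) um[OF that(2)]] by simp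
  show "x / y \<in> F" if "x \<in> F" "y \<in> F" using cl(3)[OF that(1) cl(4)[OF that(2)]]
    by (simp add: divide_inverse)
qed

lemmas differential_subfield_closed =
  differential_subfield_0 differential_subfield_1 differential_subfield_uminus
  differential_subfield_add differential_subfield_diff differential_subfield_mult
  differential_subfield_inverse differential_subfield_divide differential_subfield_der

lemma differential_subfield_poly:
  assumes "differential_subfield F" "\<And>i. coeff p i \<in> F" "x \<in> F"
  shows "poly p x \<in> F"
  using assms(2)
proof (induction p)
  case 0
  show ?case by (simp add: differential_subfield_0[OF assms(1)])
next
  case (pCons a p)
  have "a \<in> F" "\<And>i. coeff p i \<in> F"
    using pCons.prems[of 0] pCons.prems[of "Suc i" for i] by simp_all
  then show ?case
    using pCons.IH by (simp add: differential_subfield_closed[OF assms(1)] assms(3))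
qed

lemma differential_subfield_diff_adjoin: "differential_subfield (diff_adjoin B S)"
  unfolding differential_subfield_def diff_adjoin_def by blast

lemma diff_adjoin_base: "B \<subseteq> diff_adjoin B S"
  and diff_adjoin_gens: "S \<subseteq> diff_adjoin B S"
  unfolding diff_adjoin_def by blast+

lemma diff_adjoin_least:
  assumes "differential_subfield F" "B \<subseteq> F" "S \<subseteq> F"
  shows "diff_adjoin B S \<subseteq> F"
  unfolding diff_adjoin_def using assms by blast

section \<open>Arithmetic of differential operators\<close>

lemma dop_const_simps:
  "dop_const 0 = 0" "dop_const 1 = 1"
  "dop_const (a + b) = dop_const a + dop_const b"
  "dop_const (a - b) = dop_const a - dop_const b"
  "dop_const (- a) = - dop_const a"
  "dop_const (a * b) = dop_const a * dop_const b"
  by (transfer; simp add: skew_mult_pCons one_pCons)+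

lemma dop_coeff_simps:
  "dop_coeff 0 i = 0"
  "dop_coeff (P + Q) i = dop_coeff P i + dop_coeff Q i"
  "dop_coeff (P - Q) i = dop_coeff P i - dop_coeff Q i"
  "dop_coeff (- P) i = - dop_coeff P i"
  "dop_coeff (dop_const a) i = (if i = 0 then a else 0)"
  "dop_coeff (dop_const a * P) i = a * dop_coeff P i"
  "dop_coeff \<partial> i = (if i = 1 then 1 else 0)"
  by (transfer; simp add: skew_mult_pCons coeff_pCons split: nat.split)+

lemma dop_coeff_1: "dop_coeff 1 i = (if i = 0 then 1 else 0)"
  by (metis dop_coeff_simps(5) dop_const_simps(2))

lemma dop_coeff_D_times:
  "dop_coeff (\<partial> * P) i = der (dop_coeff P i) + (if i = 0 then 0 else dop_coeff P (i - 1))"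
  by transfer (simp add: skew_mult_pCons skew_shift_def coeff_map_poly coeff_pCons split: nat.split)

text \<open>
  Left multiplication by an operator over \<open>K\<close> is built from left multiplications by elements of
  \<open>K\<close> and by \<open>\<partial>\<close>, so statements about \<open>P\<close> itself can be proved by taking \<open>T = 1\<close>. The
  set \<open>S\<close> may thus be a union of cosets of a left ideal, which right multiplication does not preserve.
\<close>

lemma dop_times_induct_closed:
  assumes T: "T \<in> S" and P: "P \<in> dop_over K"
    and zero: "0 \<in> S"
    and add: "\<And>U V. U \<in> S \<Longrightarrow> V \<in> S \<Longrightarrow> U + V \<in> S"
    and const: "\<And>a U. a \<in> K \<Longrightarrow> U \<in> S \<Longrightarrow> dop_const a * U \<in> S"
    and D: "\<And>U. U \<in> S \<Longrightarrow> \<partial> * U \<in> S"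
  shows "P * T \<in> S"
proof -
  have "Dop p * T \<in> S" if "\<And>i. coeff p i \<in> K" for p
    using that T
  proof (induction p arbitrary: T)
    case 0
    have "Dop 0 * T = 0" by (simp add: zero_dop_def[symmetric])
    then show ?case using zero by simp
  next
    case (pCons a p)
    have a: "a \<in> K" and p: "\<And>i. coeff p i \<in> K"
      using pCons.prems(1)[of 0] pCons.prems(1)[of "Suc i" for i] by simp_all
    have "Dop (pCons a p) * T = dop_const a * T + Dop p * (\<partial> * T)"
      unfolding times_dop_def plus_dop_def dop_const_def dop_D_def
      by (simp add: Dop_inverse skew_mult_pCons)
    then show ?case
      using pCons.IH[OF p D[OF pCons.prems(2)]] const[OF a pCons.prems(2)] add by simp
  qed
  moreover have "\<And>i. coeff (dop_symbol P) i \<in> K"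
    using P by (simp add: dop_over_def dop_coeff.rep_eq)
  ultimately show ?thesis by (metis dop_symbol_inverse)
qed

lemma dop_const_commute:
  assumes "c \<in> constants"
  shows "dop_const c * P = P * dop_const c"
proof -
  have "P * 1 \<in> {Q. dop_const c * Q = Q * dop_const c}"
  proof (rule dop_times_induct_closed[where K = UNIV])
    fix a and U :: "'a dop" assume U: "U \<in> {Q. dop_const c * Q = Q * dop_const c}"
    have "dop_const c * dop_const a = dop_const a * dop_const c"
      by (simp add: dop_const_simps(6)[symmetric] mult.commute)
    with U show "dop_const a * U \<in> {Q. dop_const c * Q = Q * dop_const c}"
      by (simp add: mult.assoc) (metis mult.assoc)
    have "\<partial> * dop_const c = dop_const c * \<partial>"
      using assms by (simp add: dop_D_times_const constants_def dop_const_simps)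
    with U show "\<partial> * U \<in> {Q. dop_const c * Q = Q * dop_const c}"
      by (simp add: mult.assoc) (metis mult.assoc)
  qed (auto simp: dop_over_def distrib_left distrib_right)
  then show ?thesis by simp
qed

text \<open>
  Operators with a constant remainder modulo \<open>\<partial> + \<psi>\<close> are closed under left multiplication by
  \<open>\<partial>\<close>, because \<open>\<partial> q = q (\<partial> + \<psi>) + (q' - q \<psi>)\<close>.
\<close>

lemma dop_first_order_division:
  assumes K: "differential_subfield K" and \<psi>: "\<psi> \<in> K" and P: "P \<in> dop_over K"
  obtains X q where "X \<in> dop_over K" "q \<in> K" "P = X * (\<partial> + dop_const \<psi>) + dop_const q"
proof -
  let ?H = "\<partial> + dop_const \<psi>"
  let ?S = "{X * ?H + dop_const q | X q. X \<in> dop_over K \<and> q \<in> K}"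
  note cl = differential_subfield_closed[OF K]
  have "P * 1 \<in> ?S"
  proof (rule dop_times_induct_closed[OF _ P])
    show "1 \<in> ?S"
      using cl by (intro CollectI exI[of _ 0] exI[of _ 1])
        (auto simp: dop_over_def dop_coeff_simps dop_const_simps)
    show "0 \<in> ?S"
      using cl by (intro CollectI exI[of _ 0] exI[of _ 0])
        (auto simp: dop_over_def dop_coeff_simps dop_const_simps)
  next
    fix U V assume "U \<in> ?S" "V \<in> ?S"
    then obtain X q Y r where *: "U = X * ?H + dop_const q" "V = Y * ?H + dop_const r"
      "X \<in> dop_over K" "q \<in> K" "Y \<in> dop_over K" "r \<in> K" by blast
    have "U + V = (X + Y) * ?H + dop_const (q + r)"
      by (simp add: * dop_const_simps algebra_simps)
    moreover have "X + Y \<in> dop_over K" "q + r \<in> K"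
      using * cl by (auto simp: dop_over_def dop_coeff_simps)
    ultimately show "U + V \<in> ?S" by blast
  next
    fix a U assume "a \<in> K" "U \<in> ?S"
    then obtain X q where *: "U = X * ?H + dop_const q" "X \<in> dop_over K" "q \<in> K" by blast
    have "dop_const a * U = (dop_const a * X) * ?H + dop_const (a * q)"
      by (simp add: * dop_const_simps algebra_simps)
    moreover have "dop_const a * X \<in> dop_over K" "a * q \<in> K"
      using * \<open>a \<in> K\<close> cl by (auto simp: dop_over_def dop_coeff_simps)
    ultimately show "dop_const a * U \<in> ?S" by blast
  next
    fix U assume "U \<in> ?S"
    then obtain X q where *: "U = X * ?H + dop_const q" "X \<in> dop_over K" "q \<in> K" by blast
    have "\<partial> * U = (\<partial> * X + dop_const q) * ?H + dop_const (der q - q * \<psi>)"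
      unfolding *(1) dop_const_simps by (simp add: dop_D_times_const algebra_simps)
    moreover have "\<partial> * X + dop_const q \<in> dop_over K" "der q - q * \<psi> \<in> K"
      using * \<psi> cl by (auto simp: dop_over_def dop_coeff_simps dop_coeff_D_times)
    ultimately show "\<partial> * U \<in> ?S" by blast
  qed
  then show thesis using that by auto
qed

text \<open>
  The derivatives that arise when powers of \<open>\<partial>\<close> pass through the coefficients only affect lower
  orders, so the leading term is that of the commutative product.
\<close>

lemma coeff_skew_shift_pow:
  fixes q :: "'a::differential_field poly"
  assumes "i + degree q \<le> j"
  shows "coeff ((skew_shift ^^ i) q) j = (if j = i + degree q then lead_coeff q else 0)"
  using assms
proof (induction i arbitrary: j)
  case 0
  then show ?case by (simp add: coeff_eq_0)
next
  case (Suc i)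
  then obtain j' where "j = Suc j'" by (cases j) auto
  with Suc show ?case by (simp add: skew_shift_def coeff_map_poly)
qed

lemma dop_order_le_times:
  assumes "X \<noteq> 0" "P \<noteq> 0"
  shows "dop_order P \<le> dop_order (X * P)"
  using assms
proof transfer
  fix x p :: "'a poly" assume "x \<noteq> 0" "p \<noteq> 0"
  let ?n = "degree x + degree p"
  have "coeff (skew_mult x p) ?n =
      (\<Sum>i\<le>degree x. coeff x i * coeff ((skew_shift ^^ i) p) ?n)"
    by (simp add: skew_mult_def coeff_sum)
  also have "\<dots> = (\<Sum>i\<le>degree x. if i = degree x then lead_coeff x * lead_coeff p else 0)"
    by (rule sum.cong) (auto simp: coeff_skew_shift_pow)
  also have "\<dots> = lead_coeff x * lead_coeff p"
    by simp
  finally have "coeff (skew_mult x p) ?n \<noteq> 0"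
    using \<open>x \<noteq> 0\<close> \<open>p \<noteq> 0\<close> by simp
  then show "degree p \<le> degree (skew_mult x p)"
    using le_degree by fastforce
qed

lemma dop_order_0: "dop_order 0 = 0"
  by transfer simp

text \<open>
  Reduction modulo \<open>P\<close> is faithful below the order of \<open>P\<close>; this turns congruences modulo a left
  ideal into identities of coefficients.
\<close>

lemma dop_mult_eq_low_orderD:
  assumes "X * P = Y" "dop_order Y < dop_order P"
  shows "X = 0" "Y = 0"
proof -
  have "P \<noteq> 0" using assms(2) by (auto simp: dop_order_0)
  then show "X = 0" using dop_order_le_times[of X P] assms by fastforce
  then show "Y = 0" using assms(1) by simp
qed

lemma dop_symbol_first_order:
  "\<partial> - dop_const \<phi> = Dop [:-\<phi>, 1:]"
  by transfer simp

lemma dop_symbol_schrodinger: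
  "schrodinger u - dop_const l = Dop [:u - l, 0, -1:]"
  unfolding schrodinger_def power2_eq_square
  by transfer (simp add: skew_mult_pCons skew_shift_def map_poly_pCons)

lemma dop_order_Dop: "dop_order (Dop p) = degree p"
  by (simp add: dop_order.rep_eq Dop_inverse)

lemma dop_order_first_order: "dop_order (\<partial> - dop_const \<phi>) = 1"
  by (simp add: dop_symbol_first_order dop_order_Dop)

lemma dop_order_schrodinger: "dop_order (schrodinger u - dop_const l) = 2"
  by (simp add: dop_symbol_schrodinger dop_order_Dop)

lemma dop_order_const: "dop_order (dop_const a) = 0"
  by transfer simp

section \<open>The remainder of the partner\<close>

text \<open>
  A first-order right factor \<open>\<partial> - \<phi>\<close> amounts to a solution \<open>\<phi>\<close> of the Riccati equation: the
  remainder of \<open>L - l\<close> modulo \<open>\<partial> - \<phi>\<close> is \<open>u - l - (\<phi>' + \<phi>\<^sup>2)\<close>.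
\<close>

lemma schrodinger_factor:
  assumes "schrodinger u - dop_const l = Q * (\<partial> - dop_const \<phi>)"
  shows "u - l = der \<phi> + \<phi>\<^sup>2"
    and "schrodinger u - dop_const l = - (\<partial> + dop_const \<phi>) * (\<partial> - dop_const \<phi>)"
proof -
  let ?G = "\<partial> - dop_const \<phi>"
  have eq: "schrodinger u - dop_const l
      = - (\<partial> + dop_const \<phi>) * ?G + dop_const (u - l - (der \<phi> + \<phi>\<^sup>2))"
    unfolding schrodinger_def power2_eq_square
    by (simp add: dop_const_simps dop_D_times_const algebra_simps)
  with assms have "(Q + (\<partial> + dop_const \<phi>)) * ?G = dop_const (u - l - (der \<phi> + \<phi>\<^sup>2))"
    by (simp add: algebra_simps)
  then have 0: "dop_const (u - l - (der \<phi> + \<phi>\<^sup>2)) = 0"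
    by (rule dop_mult_eq_low_orderD(2)) (simp add: dop_order_const dop_order_first_order)
  then have "dop_coeff (dop_const (u - l - (der \<phi> + \<phi>\<^sup>2))) 0 = 0"
    by (simp only: dop_coeff_simps)
  then show "u - l = der \<phi> + \<phi>\<^sup>2"
    by (simp add: dop_coeff_simps)
  show "schrodinger u - dop_const l = - (\<partial> + dop_const \<phi>) * ?G"
    using eq 0 by simp
qed

text \<open>
  Modulo the left ideal of \<open>L - l\<close> every power of \<open>L\<close> is the corresponding power of \<open>l\<close>; that \<open>l\<close>
  is constant is needed to move \<open>l\<^sup>i\<close> past \<open>L\<close>.
\<close>

lemma dop_poly_remainder:
  assumes l: "l \<in> constants"
  obtains Y where "dop_poly R L = dop_const (poly R l) + Y * (L - dop_const l)"
proof -
  let ?I = "{P. \<exists>Y. P = Y * (L - dop_const l)}"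
  have add: "P + Q \<in> ?I" if "P \<in> ?I" "Q \<in> ?I" for P Q
    using that by (auto simp flip: distrib_right)
  have left: "T * P \<in> ?I" if "P \<in> ?I" for T P
    using that by (auto simp flip: mult.assoc)
  have pow: "L ^ i - dop_const (l ^ i) \<in> ?I" for i
  proof (induction i)
    case 0
    show ?case by (auto simp: dop_const_simps intro: exI[of _ 0])
  next
    case (Suc i)
    have "L ^ Suc i - dop_const (l ^ Suc i)
        = L * (L ^ i - dop_const (l ^ i)) + (dop_const (l ^ i) * (L - dop_const l))"
    proof -
      have "l ^ i \<in> constants"
        using l by (induction i) (auto simp: constants_def der_mult)
      then have "L * dop_const (l ^ i) = dop_const (l ^ i) * L"
        by (rule dop_const_commute[symmetric])
      then show ?thesis
        by (simp add: right_diff_distrib dop_const_simps(6)[symmetric] mult.commute[of l])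
    qed
    moreover have "L - dop_const l \<in> ?I" by (auto intro: exI[of _ 1])
    ultimately show ?case using add[OF left[OF Suc, of L] left] by metis
  qed
  have sum: "(\<Sum>i\<in>I. f i) \<in> ?I" if "\<And>i. f i \<in> ?I" for f and I :: "nat set"
    by (induction I rule: infinite_finite_induct) (use add that in \<open>auto intro: exI[of _ 0]\<close>)
  have "dop_const (poly R l) = (\<Sum>i\<le>degree R. dop_const (coeff R i) * dop_const (l ^ i))"
  proof -
    have "dop_const (sum f I) = (\<Sum>i\<in>I. dop_const (f i))" for f :: "nat \<Rightarrow> 'a" and I
      by (induction I rule: infinite_finite_induct) (simp_all add: dop_const_simps)
    then show ?thesis by (simp add: poly_altdef dop_const_simps)
  qed
  then have "dop_poly R L - dop_const (poly R l)
      = (\<Sum>i\<le>degree R. dop_const (coeff R i) * (L ^ i - dop_const (l ^ i)))"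
    by (simp add: dop_poly_def sum_subtractf right_diff_distrib)
  also have "\<dots> \<in> ?I" by (rule sum[OF left[OF pow]])
  finally show thesis using that by (auto simp: algebra_simps)
qed

text \<open>
  With \<open>B = A - m = X N + a G\<close> and \<open>N = L - l\<close>, the curve gives \<open>B\<^sup>2 + 2 m B \<equiv> 0\<close> modulo the left
  ideal of \<open>N\<close>. Since \<open>B\<close> commutes with \<open>N\<close>, also \<open>N a G \<equiv> 0\<close>, so that \<open>B\<close> may be replaced by
  \<open>a G\<close>. As \<open>G a = a G + a'\<close> and \<open>G\<^sup>2 \<equiv> -2 \<phi> G\<close>, what remains is
  \<open>(a a' - 2 a\<^sup>2 \<phi> + 2 m a) G \<equiv> 0\<close>; its left side has order at most one, hence vanishes.
\<close>

lemma partner_remainder_equation: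
  fixes A X :: "'a::differential_field dop"
  assumes m: "m \<in> constants" and l: "l \<in> constants" and curve: "m ^ 2 + poly R l = 0"
    and comm: "A \<in> centralizer L" and square: "A ^ 2 + dop_poly R L = 0"
    and M: "L - dop_const l = - (\<partial> + dop_const \<phi>) * (\<partial> - dop_const \<phi>)"
    and order: "dop_order (L - dop_const l) = 2"
    and A: "A - dop_const m = X * (L - dop_const l) + dop_const a * (\<partial> - dop_const \<phi>)"
    and a: "a \<noteq> 0"
  shows "der a = 2 * a * \<phi> - 2 * m"
proof -
  define N where "N = L - dop_const l"
  define B where "B = A - dop_const m"
  define G where "G = \<partial> - dop_const \<phi>"
  define \<alpha> where "\<alpha> = dop_const a"
  define \<mu> where "\<mu> = dop_const m"
  have B: "B = X * N + \<alpha> * G" using A by (simp add: N_def B_def G_def \<alpha>_def)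
  have \<mu>: "P * \<mu> = \<mu> * P" for P
    using dop_const_commute[OF m, of P] by (simp add: \<mu>_def)
  have NB: "N * B = B * N"
  proof -
    have "L * A = A * L" using comm by (simp add: centralizer_def)
    moreover have "A * dop_const l = dop_const l * A" "L * dop_const m = dop_const m * L"
      "dop_const m * dop_const l = dop_const l * dop_const m"
      using dop_const_commute[OF l, of A] dop_const_commute[OF m, of L]
        dop_const_commute[OF m, of "dop_const l"] by simp_all
    ultimately show ?thesis by (simp add: N_def B_def algebra_simps)
  qed
  \<comment> \<open>the only use of commutation: \<open>a G\<close> stays in the left ideal of \<open>N\<close> when multiplied by \<open>N\<close>\<close>
  have NaG: "N * \<alpha> * G = (B - N * X) * N"
  proof -
    have "N * \<alpha> * G = N * B - N * X * N" by (simp add: B algebra_simps)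
    then show ?thesis unfolding NB by (simp add: algebra_simps)
  qed
  obtain Y where Y: "dop_poly R L = dop_const (poly R l) + Y * N"
    using dop_poly_remainder[OF l] N_def by metis
  have "A ^ 2 = \<mu> * \<mu> - Y * N"
  proof -
    have "dop_const (m * m + poly R l) = 0"
      using curve by (simp add: power2_eq_square dop_const_simps)
    then have "\<mu> * \<mu> = - dop_const (poly R l)"
      by (simp add: \<mu>_def dop_const_simps eq_neg_iff_add_eq_0)
    moreover have "A ^ 2 = - dop_poly R L" using square by (simp add: eq_neg_iff_add_eq_0)
    ultimately show ?thesis using Y by simp
  qed
  moreover have "A = B + \<mu>" by (simp add: B_def \<mu>_def)
  then have "A ^ 2 = B * B + (\<mu> * B + \<mu> * B) + \<mu> * \<mu>"
    by (simp add: power2_eq_square algebra_simps \<mu>[of B])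
  ultimately have BB: "B * B + (\<mu> * B + \<mu> * B) = - Y * N"
    by (metis add_diff_cancel_right' add.commute diff_conv_add_uminus mult_minus_left)
  have B2: "B * B = B * X * N + X * (N * \<alpha> * G) + \<alpha> * G * \<alpha> * G"
    using arg_cong[OF B, of "\<lambda>x. B * x"] arg_cong[OF B, of "\<lambda>x. x * \<alpha> * G"]
    by (simp add: distrib_left distrib_right mult.assoc)
  have \<mu>B: "\<mu> * B = \<mu> * X * N + \<mu> * \<alpha> * G"
    by (simp add: B distrib_left mult.assoc)
  \<comment> \<open>the cofactor of \<open>N\<close> left after all multiples of \<open>N\<close> have been collected on one side\<close>
  define Z where "Z = - Y - B * X - X * (B - N * X) - (\<mu> * X + \<mu> * X)"
  have "\<alpha> * G * \<alpha> * G + (\<mu> * \<alpha> * G + \<mu> * \<alpha> * G) = Z * N"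
  proof -
    have "\<alpha> * G * \<alpha> * G = B * B - B * X * N - X * ((B - N * X) * N)"
      using B2 unfolding NaG by simp
    also have "B * B = - Y * N - (\<mu> * B + \<mu> * B)" using BB by (simp add: algebra_simps)
    finally show ?thesis unfolding \<mu>B Z_def by (simp add: algebra_simps)
  qed
  moreover have "\<alpha> * G * \<alpha> * G = - \<alpha> * \<alpha> * N + dop_const (a * der a - 2 * a * a * \<phi>) * G"
  proof -
    have 1: "G * \<alpha> = \<alpha> * G + dop_const (der a)"
      by (simp add: G_def \<alpha>_def algebra_simps dop_D_times_const)
        (simp add: dop_const_simps(6)[symmetric] mult.commute)
    have 2: "G * G = - N - (dop_const \<phi> + dop_const \<phi>) * G"
      unfolding N_def M G_def by (simp add: algebra_simps)
    have "\<alpha> * G * \<alpha> * G = \<alpha> * (G * \<alpha>) * G" by (simp add: mult.assoc)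
    also have "\<dots> = \<alpha> * \<alpha> * (G * G) + \<alpha> * dop_const (der a) * G"
      unfolding 1 by (simp add: algebra_simps)
    also have "\<dots> = - \<alpha> * \<alpha> * N
        + (\<alpha> * dop_const (der a) - \<alpha> * \<alpha> * (dop_const \<phi> + dop_const \<phi>)) * G"
      unfolding 2 by (simp add: algebra_simps)
    also have "\<alpha> * dop_const (der a) - \<alpha> * \<alpha> * (dop_const \<phi> + dop_const \<phi>)
        = dop_const (a * der a - 2 * a * a * \<phi>)"
      by (simp only: \<alpha>_def dop_const_simps(3-6)[symmetric]) (simp add: algebra_simps)
    finally show ?thesis .
  qed
  moreover have "\<mu> * \<alpha> * G + \<mu> * \<alpha> * G = dop_const (2 * m * a) * G"
    by (simp only: \<mu>_def \<alpha>_def dop_const_simps(3-6)[symmetric] distrib_right[symmetric])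
      (simp add: algebra_simps)
  ultimately have "- \<alpha> * \<alpha> * N + dop_const (a * der a - 2 * a * a * \<phi>) * G
      + dop_const (2 * m * a) * G = Z * N" by (simp only:)
  then have "(Z + \<alpha> * \<alpha>) * N
      = (dop_const (a * der a - 2 * a * a * \<phi>) + dop_const (2 * m * a)) * G"
    by (simp only: distrib_right mult_minus_left) (simp add: algebra_simps)
  then have "(Z + \<alpha> * \<alpha>) * N = dop_const (a * der a - 2 * a * a * \<phi> + 2 * m * a) * G"
    (is "_ = dop_const ?c * G") by (simp only: dop_const_simps(3))
  moreover have "dop_order (dop_const ?c * G) < dop_order N"
  proof -
    have "dop_order (dop_const ?c * G) \<le> 1"
      unfolding G_def dop_symbol_first_order
      by transfer (simp add: skew_mult_pCons degree_pCons_le)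
    then show ?thesis using order by (simp add: N_def)
  qed
  ultimately have "dop_const ?c * G = 0" by (rule dop_mult_eq_low_orderD(2))
  then have "dop_const ?c = 0"
    by (rule dop_mult_eq_low_orderD(1)) (simp add: G_def dop_order_first_order dop_order_0)
  then have "dop_coeff (dop_const ?c) 0 = 0" by (simp only: dop_coeff_simps)
  then have "a * (der a - 2 * a * \<phi> + 2 * m) = 0"
    by (simp add: dop_coeff_simps algebra_simps)
  then have "der a - 2 * a * \<phi> + 2 * m = 0" using a by (metis mult_eq_0_iff)
  then show ?thesis by (simp add: algebra_simps add_eq_0_iff2)
qed

text \<open>
  If \<open>a\<close> were \<open>0\<close>, then \<open>L - l\<close>, of order two, would divide both operators and hence their greatest
  common right divisor, which has order one.
\<close>

lemma partner_remainder:
  fixes u :: "'a::differential_field"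
  assumes K: "differential_subfield K" and l: "l \<in> constants" and m: "m \<in> constants"
    and uK: "u \<in> K" and CK: "constants \<subseteq> K"
    and partner: "is_partner (schrodinger u) s A R"
    and curve: "m ^ 2 + poly R l = 0"
    and gcrd: "is_gcrd_over K (\<partial> - dop_const \<phi>) (schrodinger u - dop_const l) (A - dop_const m)"
  obtains a where "\<phi> \<in> K" "u - l = der \<phi> + \<phi>\<^sup>2" "a \<in> K" "a \<noteq> 0"
    "der a = 2 * a * \<phi> - 2 * m"
proof -
  let ?G = "\<partial> - dop_const \<phi>" and ?M = "schrodinger u - dop_const l"
  note cl = differential_subfield_closed[OF K]
  have "?G \<in> dop_over K" using gcrd by (simp add: is_gcrd_over_def)
  then have "dop_coeff ?G 0 \<in> K" by (simp only: dop_over_def mem_Collect_eq)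
  then have \<phi>: "\<phi> \<in> K" using cl(3)[of "- \<phi>"] by (simp add: dop_coeff_simps)
  obtain Q where Q: "?M = Q * ?G"
    using gcrd unfolding is_gcrd_over_def right_divides_over_def by blast
  note fac = schrodinger_factor[OF Q]
  obtain P where P: "P \<in> dop_over K" "A - dop_const m = P * ?G"
    using gcrd unfolding is_gcrd_over_def right_divides_over_def by blast
  obtain X a where X: "X \<in> dop_over K" "a \<in> K" "P = X * (\<partial> + dop_const \<phi>) + dop_const a"
    using dop_first_order_division[OF K \<phi> P(1)] .
  have A: "A - dop_const m = (- X) * ?M + dop_const a * ?G"
    unfolding P(2) X(3) fac(2)
    by (simp only: distrib_right[of "X * (\<partial> + dop_const \<phi>)"] mult.assoc mult_minus_left
      mult_minus_right minus_minus)
  have "a \<noteq> 0"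
  proof
    assume "a = 0"
    then have eq: "A - dop_const m = (- X) * ?M" using A by (simp add: dop_const_simps)
    have "- X \<in> dop_over K" using X(1) cl by (simp add: dop_over_def dop_coeff_simps)
    then have "right_divides_over K ?M (A - dop_const m)"
      unfolding right_divides_over_def using eq by (intro bexI[of _ "- X"])
    moreover have "right_divides_over K ?M ?M"
      unfolding right_divides_over_def
      by (rule bexI[of _ 1]) (auto simp: dop_over_def dop_coeff_1 cl)
    moreover have "?M \<in> dop_over K"
      using uK l CK cl by (auto simp: dop_over_def dop_symbol_schrodinger dop_coeff.rep_eq
        Dop_inverse coeff_pCons split: nat.split)
    ultimately have "right_divides_over K ?M ?G"
      using gcrd unfolding is_gcrd_over_def by blast
    then obtain Y where "Y * ?M = ?G" unfolding right_divides_over_def by metis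
    then have "?G = 0"
      by (rule dop_mult_eq_low_orderD(2))
        (simp add: dop_order_first_order dop_order_schrodinger)
    then have "dop_order ?G = 0" by (simp add: dop_order_0)
    then show False by (simp add: dop_order_first_order)
  qed
  moreover have "der a = 2 * a * \<phi> - 2 * m"
    using partner by (intro partner_remainder_equation[OF m l curve _ _ fac(2) _ A \<open>a \<noteq> 0\<close>])
      (auto simp: is_partner_def dop_order_schrodinger)
  ultimately show thesis using that \<phi> fac(1) X(2) by blast
qed

section \<open>Picard-Vessiot extensions of Schroedinger equations\<close>

text \<open>
  Cramer's rule: the coefficients are quotients of Wronskians, and the Wronskian of two solutions of
  \<open>y'' = v y\<close> is constant because the equation has no term in \<open>y'\<close>.
\<close>

lemma wronskian_span:
  fixes f g h v :: "'a::differential_field"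
  assumes f: "der (der f) = v * f" and g: "der (der g) = v * g" and h: "der (der h) = v * h"
    and W: "f * der g - der f * g \<noteq> 0"
  obtains c d where "c \<in> constants" "d \<in> constants" "h = c * f + d * g"
proof -
  have W0: "der (p * der q - der p * q) = 0" if "der (der p) = v * p" "der (der q) = v * q" for p q
    using that by (simp add: der_diff der_mult algebra_simps)
  define w where "w = f * der g - der f * g"
  have quot: "x / w \<in> constants" if "der x = 0" for x
  proof -
    have "x = x / w * w" using W by (simp add: w_def)
    then have "der x = der (x / w) * w + x / w * der w" by (metis der_mult)
    then show ?thesis using that W W0[OF f g] by (simp add: w_def constants_def)
  qed
  have "(h * der g - der h * g) / w * f + (f * der h - der f * h) / w * g
      = ((h * der g - der h * g) * f + (f * der h - der f * h) * g) / w"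
    by (simp only: add_divide_distrib times_divide_eq_left)
  also have "(h * der g - der h * g) * f + (f * der h - der f * h) * g = h * w"
    by (simp add: w_def algebra_simps)
  also have "h * w / w = h" using W by (simp add: w_def)
  finally show thesis using that quot W0 f g h by metis
qed

text \<open>
  For \<open>y'' = v y\<close>, linear independence over the constants is the nonvanishing of the Wronskian: if it
  vanishes, the quotient of the two solutions has derivative \<open>0\<close>.
\<close>

lemma fundamental_set_order_2:
  assumes V: "\<And>z. dop_apply M z = 0 \<longleftrightarrow> der (der z) = v * z" and ord: "dop_order M = 2"
  shows "fundamental_set M Y \<longleftrightarrow>
    (\<exists>f g. Y = {f, g} \<and> der (der f) = v * f \<and> der (der g) = v * g \<and>
      f * der g - der f * g \<noteq> 0)"
proof
  assume Y: "fundamental_set M Y"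
  then have "card Y = 2" by (simp add: fundamental_set_def ord)
  then obtain f g where fg: "Y = {f, g}" "f \<noteq> g" by (auto simp: card_2_iff)
  have indep: "c = 0 \<and> d = 0" if "c \<in> constants" "d \<in> constants" "c * f + d * g = 0" for c d
  proof -
    \<comment> \<open>coefficient functions live on the set \<open>Y\<close>, so a pair of coefficients needs \<open>f \<noteq> g\<close>\<close>
    let ?c = "\<lambda>y. if y = f then c else d"
    have "(\<forall>y\<in>Y. ?c y \<in> constants) \<and> (\<Sum>y\<in>Y. ?c y * y) = 0" using that fg by auto
    moreover have "\<forall>c. (\<forall>y\<in>Y. c y \<in> constants) \<and> (\<Sum>y\<in>Y. c y * y) = 0 \<longrightarrow> (\<forall>y\<in>Y. c y = 0)"
      using Y by (simp add: fundamental_set_def)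
    ultimately have "\<forall>y\<in>Y. ?c y = 0" by (elim allE[of _ ?c] mp)
    then show ?thesis using fg by auto
  qed
  have "f * der g - der f * g \<noteq> 0"
  proof
    assume W: "f * der g - der f * g = 0"
    have f0: "f \<noteq> 0" using indep[of 1 0] by (auto simp: constants_def)
    have "g = g / f * f" using f0 by simp
    then have "der g = der (g / f) * f + g / f * der f" by (metis der_mult)
    then have "der (g / f) * f * f = f * der g - der f * g" using f0 by (simp add: field_simps)
    then have "g / f \<in> constants" using W f0 by (simp add: constants_def)
    moreover have "- 1 \<in> (constants :: 'a set)" by (simp add: constants_def der_minus)
    ultimately show False using indep[of "g / f" "- 1"] f0 by simp
  qed
  moreover have "der (der f) = v * f" "der (der g) = v * g"
    using Y fg by (auto simp: fundamental_set_def V)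
  ultimately show "\<exists>f g. Y = {f, g} \<and> der (der f) = v * f \<and> der (der g) = v * g \<and>
      f * der g - der f * g \<noteq> 0" using fg by blast
next
  assume "\<exists>f g. Y = {f, g} \<and> der (der f) = v * f \<and> der (der g) = v * g \<and>
      f * der g - der f * g \<noteq> 0"
  then obtain f g where fg: "Y = {f, g}" "der (der f) = v * f" "der (der g) = v * g"
    and W: "f * der g - der f * g \<noteq> 0" by blast
  have ne: "f \<noteq> g" using W by (auto simp: mult.commute)
  have "c f = 0 \<and> c g = 0"
    if c: "c f \<in> constants" "c g \<in> constants" "c f * f + c g * g = 0" for c
  proof -
    have "der (c f * f + c g * g) = 0" using c(3) by simp
    then have d: "c f * der f + c g * der g = 0"
      using c(1,2) by (simp add: der_add der_mult constants_def)
    have "c f * (f * der g - der f * g)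
        = der g * (c f * f + c g * g) - g * (c f * der f + c g * der g)"
      "c g * (f * der g - der f * g)
        = f * (c f * der f + c g * der g) - der f * (c f * f + c g * g)"
      by (simp_all add: algebra_simps)
    then show ?thesis using c(3) d W by simp
  qed
  then show "fundamental_set M Y"
    using fg ne by (auto simp: fundamental_set_def ord V)
qed

text \<open>
  Under the equation for \<open>a\<close>, the element \<open>w = a / y\<close> is a second solution, with \<open>y w' - y' w = -2 m\<close>.
  Hence \<open>k\<langle>y\<rangle>\<close> contains a basis of the solutions. Conversely, any basis of solutions expresses \<open>y\<close>
  with constant coefficients, and these lie in \<open>k\<close>, so it generates nothing smaller.
\<close>

lemma picard_vessiot_iff_exponential:
  fixes k :: "'u::differential_field set"
  assumes k: "differential_subfield k" and C: "constants \<subseteq> k"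
    and V: "\<And>z. dop_apply M z = 0 \<longleftrightarrow> der (der z) = v * z" and ord: "dop_order M = 2"
    and v: "v = der \<phi> + \<phi>\<^sup>2"
    and a: "a \<in> k" "a \<noteq> 0" "der a = 2 * a * \<phi> - 2 * m" and m: "m \<in> constants" "m \<noteq> 0"
    and y: "y \<noteq> 0" "der y = \<phi> * y"
  shows "picard_vessiot k M F \<longleftrightarrow> F = diff_adjoin k {y}"
proof -
  let ?E = "diff_adjoin k {y}"
  note clE = differential_subfield_closed[OF differential_subfield_diff_adjoin]
  have CE: "constants \<subseteq> diff_adjoin k S" for S using C diff_adjoin_base by blast
  define w where "w = a / y"
  have yE: "y \<in> ?E" using diff_adjoin_gens by blast
  have wE: "w \<in> ?E" unfolding w_def using a(1) diff_adjoin_base yE by (blast intro: clE)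
  have wy: "w * y = a" using y by (simp add: w_def)
  have sol_y: "der (der y) = v * y"
    by (simp add: y v der_mult algebra_simps power2_eq_square)
  \<comment> \<open>working with \<open>w y = a\<close> avoids differentiating a quotient\<close>
  have dwy: "der w * y = a * \<phi> - 2 * m"
  proof -
    have "der w * y + \<phi> * (w * y) = der a"
      using arg_cong[OF wy, of der] y(2) by (simp add: der_mult algebra_simps)
    then show ?thesis unfolding wy a(3) by (simp add: algebra_simps)
  qed
  have sol_w: "der (der w) = v * w"
  proof -
    have "der m = 0" using m by (simp add: constants_def)
    have "der (2 :: 'u) = 0" using der_add[of 1 "1::'u"] by simp
    have "der (der w) * y + der w * (\<phi> * y) = der a * \<phi> + a * der \<phi>"
      using arg_cong[OF dwy, of der] y(2) \<open>der m = 0\<close> \<open>der 2 = 0\<close>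
      by (simp add: der_mult der_diff)
    then have "der (der w) * y + \<phi> * (der w * y) = der a * \<phi> + a * der \<phi>"
      by (simp add: algebra_simps)
    then have "der (der w) * y + \<phi> * (a * \<phi> - 2 * m) = der a * \<phi> + a * der \<phi>"
      unfolding dwy .
    then have "der (der w) * y = v * w * y"
      using wy a(3) v by (simp add: algebra_simps power2_eq_square)
    then show ?thesis using y by simp
  qed
  have W: "y * der w - der y * w \<noteq> 0"
  proof -
    have "y * der w - der y * w = der w * y - \<phi> * (w * y)" using y(2) by (simp add: algebra_simps)
    also have "\<dots> = - 2 * m" using dwy wy by (simp add: algebra_simps)
    finally show ?thesis using m by simp
  qed
  show ?thesis
  proof
    assume "picard_vessiot k M F"
    then obtain Y where Y: "fundamental_set M Y" "F = diff_adjoin k Y"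
      unfolding picard_vessiot_def by blast
    obtain f g where fg: "Y = {f, g}" "der (der f) = v * f" "der (der g) = v * g"
      "f * der g - der f * g \<noteq> 0"
      using Y(1) unfolding fundamental_set_order_2[OF V ord] by blast
    have inE: "z \<in> ?E" if z: "der (der z) = v * z" for z
    proof -
      obtain c d where "c \<in> constants" "d \<in> constants" "z = c * y + d * w"
        using wronskian_span[OF sol_y sol_w z W] .
      then show ?thesis using yE wE CE by (auto intro!: clE)
    qed
    have "y \<in> F"
    proof -
      obtain c d where "c \<in> constants" "d \<in> constants" "y = c * f + d * g"
        using wronskian_span[OF fg(2,3) sol_y fg(4)] .
      moreover have "f \<in> F" "g \<in> F" using diff_adjoin_gens[of Y k] fg(1) Y(2) by auto
      ultimately show ?thesis using CE unfolding Y(2) by (auto intro!: clE)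
    qed
    then show "F = ?E"
      using diff_adjoin_least[OF differential_subfield_diff_adjoin diff_adjoin_base, of Y k "{y}"]
        diff_adjoin_least[OF differential_subfield_diff_adjoin diff_adjoin_base, of "{y}" k Y]
        inE fg Y(2) by blast
  next
    assume F: "F = ?E"
    have "fundamental_set M {y, w}"
      unfolding fundamental_set_order_2[OF V ord] using sol_y sol_w W by blast
    moreover have "F = diff_adjoin k {y, w}"
      unfolding F
      by (intro equalityI diff_adjoin_least differential_subfield_diff_adjoin diff_adjoin_base)
        (use yE wE diff_adjoin_gens[of "{y, w}" k] in auto)
    moreover have "F \<inter> constants = k \<inter> constants"
      using CE[of "{y}"] C F by blast
    ultimately show "picard_vessiot k M F" unfolding picard_vessiot_def by blast
  qed
qed

section \<open>Embeddings of differential fields\<close>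

lemma
  assumes K: "differential_subfield K" and \<iota>: "differential_embedding K \<iota>"
  shows embedding_1: "\<iota> 1 = 1"
    and embedding_add: "x \<in> K \<Longrightarrow> y \<in> K \<Longrightarrow> \<iota> (x + y) = \<iota> x + \<iota> y"
    and embedding_mult: "x \<in> K \<Longrightarrow> y \<in> K \<Longrightarrow> \<iota> (x * y) = \<iota> x * \<iota> y"
    and embedding_der: "x \<in> K \<Longrightarrow> \<iota> (der x) = der (\<iota> x)"
    and embedding_0: "\<iota> 0 = 0"
    and embedding_diff: "x \<in> K \<Longrightarrow> y \<in> K \<Longrightarrow> \<iota> (x - y) = \<iota> x - \<iota> y"
    and embedding_uminus: "x \<in> K \<Longrightarrow> \<iota> (- x) = - \<iota> x"
    and embedding_eq_0: "x \<in> K \<Longrightarrow> \<iota> x = 0 \<longleftrightarrow> x = 0"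
    and embedding_inverse: "x \<in> K \<Longrightarrow> \<iota> (inverse x) = inverse (\<iota> x)"
proof -
  note cl = differential_subfield_closed[OF K]
  show 1: "\<iota> 1 = 1" and add: "x \<in> K \<Longrightarrow> y \<in> K \<Longrightarrow> \<iota> (x + y) = \<iota> x + \<iota> y"
    and mult: "x \<in> K \<Longrightarrow> y \<in> K \<Longrightarrow> \<iota> (x * y) = \<iota> x * \<iota> y"
    and "x \<in> K \<Longrightarrow> \<iota> (der x) = der (\<iota> x)" for x y
    using \<iota> unfolding differential_embedding_def by blast+
  show 0: "\<iota> 0 = 0" using add[of 0 0] cl(1) by simp
  show diff: "\<iota> (x - y) = \<iota> x - \<iota> y" if "x \<in> K" "y \<in> K" for x y
    using add[of "x - y" y] that cl(5) by simp
  show "\<iota> (- x) = - \<iota> x" if "x \<in> K" for x using diff[of 0 x] that cl(1) 0 by simp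
  show eq0: "\<iota> x = 0 \<longleftrightarrow> x = 0" if "x \<in> K" for x
    using mult[of x "inverse x"] that cl(7)[of x] 0 1 cl(1) by (cases "x = 0") auto
  show "\<iota> (inverse x) = inverse (\<iota> x)" if "x \<in> K" for x
    using mult[of x "inverse x"] that cl(7)[of x] 0 1 cl(1) eq0[of x]
    by (cases "x = 0") (auto simp: field_simps)
qed

lemma differential_subfield_embedding_image:
  assumes K: "differential_subfield K" and \<iota>: "differential_embedding K \<iota>"
  shows "differential_subfield (\<iota> ` K)"
  unfolding differential_subfield_def
proof (intro conjI ballI)
  note cl = differential_subfield_closed[OF K]
  show "1 \<in> \<iota> ` K" using embedding_1[OF K \<iota>] cl by force
  fix x assume "x \<in> \<iota> ` K"
  then obtain a where a: "a \<in> K" "x = \<iota> a" by blast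
  show "inverse x \<in> \<iota> ` K" "der x \<in> \<iota> ` K"
    using a cl embedding_inverse[OF K \<iota> a(1)] embedding_der[OF K \<iota> a(1)]
    by (metis imageI)+
  fix y assume "y \<in> \<iota> ` K"
  then obtain b where b: "b \<in> K" "y = \<iota> b" by blast
  show "x - y \<in> \<iota> ` K" "x * y \<in> \<iota> ` K"
    using a b cl embedding_diff[OF K \<iota> a(1) b(1)] embedding_mult[OF K \<iota> a(1) b(1)]
    by (metis imageI)+
qed

lemma embedding_image_constants:
  assumes K: "differential_subfield K" and \<iota>: "differential_embedding K \<iota>"
    and C: "constants \<subseteq> K"
  shows "\<iota> ` K \<inter> constants = \<iota> ` constants"
proof -
  have "\<iota> x \<in> constants \<longleftrightarrow> x \<in> constants" if "x \<in> K" for x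
    using that embedding_der[OF K \<iota> that]
      embedding_eq_0[OF K \<iota> differential_subfield_der[OF K that]]
    by (simp add: constants_def)
  then show ?thesis using C by blast
qed

text \<open>
  The closedness is transported by pulling a polynomial back along \<open>\<iota>\<close>. The detour over preimages is
  needed because \<open>\<iota>\<close> is a homomorphism on \<open>K\<close> only.
\<close>

lemma embedding_algebraically_closed:
  assumes K: "differential_subfield K" and \<iota>: "differential_embedding K \<iota>"
    and C: "constants \<subseteq> K" and closed: "algebraically_closed (constants :: 'a set)"
  shows "algebraically_closed (\<iota> ` (constants :: 'a::differential_field set))"
  unfolding algebraically_closed_def
proof (intro allI impI, elim conjE)
  fix p assume p: "\<forall>i. coeff p i \<in> \<iota> ` constants" "degree p > 0"
  note cl = differential_subfield_closed[OF K]
  let ?g = "inv_into constants \<iota>"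
  have inj: "inj_on \<iota> constants"
  proof (rule inj_onI)
    fix x y :: 'a assume "x \<in> constants" "y \<in> constants" "\<iota> x = \<iota> y"
    then show "x = y"
      using embedding_diff[OF K \<iota>, of x y] embedding_eq_0[OF K \<iota> cl(5), of x y] C by auto
  qed
  have "0 \<in> (constants :: 'a set)" by (simp add: constants_def)
  then have g0: "?g 0 = 0" using inv_into_f_f[OF inj, of 0] embedding_0[OF K \<iota>] by simp
  define q where "q = map_poly ?g p"
  have q: "coeff q i \<in> constants" for i
    using p(1) g0 by (simp add: q_def coeff_map_poly inv_into_into)
  have p_q: "p = map_poly \<iota> q"
    by (rule poly_eqI)
      (use p(1) in \<open>simp add: q_def coeff_map_poly g0 embedding_0[OF K \<iota>] f_inv_into_f\<close>)
  have "degree q > 0" using map_poly_degree_leq[of \<iota> q] p(2) p_q by simp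
  then obtain x where x: "x \<in> constants" "poly q x = 0"
    using closed q unfolding algebraically_closed_def by blast
  have hom: "\<iota> (poly f x) = poly (map_poly \<iota> f) (\<iota> x)" if "\<And>i. coeff f i \<in> K" for f
    using that
  proof (induction f)
    case (pCons a f)
    have f: "a \<in> K" "\<And>i. coeff f i \<in> K"
      using pCons.prems[of 0] pCons.prems[of "Suc i" for i] by simp_all
    have "x \<in> K" "poly f x \<in> K" using x C differential_subfield_poly[OF K f(2)] by auto
    then show ?case
      using f pCons.IH cl
      by (simp add: map_poly_pCons embedding_0[OF K \<iota>] embedding_add[OF K \<iota>]
        embedding_mult[OF K \<iota>])
  qed (simp add: embedding_0[OF K \<iota>])
  have "coeff q i \<in> K" for i using q C by blast
  then have "poly p (\<iota> x) = 0" using hom[of q] x(2) p_q embedding_0[OF K \<iota>] by simp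
  then show "\<exists>x\<in>\<iota> ` constants. poly p x = 0" using x(1) by blast
qed

lemma dop_apply_Dop: "dop_apply (Dop p) z = (\<Sum>i\<le>degree p. coeff p i * (der ^^ i) z)"
  by (simp add: dop_apply_def dop_order_Dop dop_coeff.rep_eq Dop_inverse)

lemma dop_apply_map_first_order:
  assumes "differential_subfield K" "differential_embedding K \<iota>" "\<phi> \<in> K"
  shows "dop_apply (map_dop \<iota> (\<partial> - dop_const \<phi>)) y = der y - \<iota> \<phi> * y"
proof -
  have "map_dop \<iota> (\<partial> - dop_const \<phi>) = Dop [:- \<iota> \<phi>, 1:]"
    unfolding dop_symbol_first_order map_dop_def
    using assms by (simp add: Dop_inverse map_poly_pCons embedding_0 embedding_1 embedding_uminus)
  then show ?thesis by (simp add: dop_apply_Dop)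
qed

lemma map_dop_schrodinger:
  assumes K: "differential_subfield K" and \<iota>: "differential_embedding K \<iota>" and "u - l \<in> K"
  shows "dop_apply (map_dop \<iota> (schrodinger u - dop_const l)) z = \<iota> (u - l) * z - der (der z)"
    and "dop_order (map_dop \<iota> (schrodinger u - dop_const l)) = 2"
proof -
  have "map_dop \<iota> (schrodinger u - dop_const l) = Dop [:\<iota> (u - l), 0, - 1:]"
    unfolding dop_symbol_schrodinger map_dop_def
    using assms differential_subfield_1[OF K]
    by (simp add: Dop_inverse map_poly_pCons embedding_0[OF K \<iota>] embedding_1[OF K \<iota>]
      embedding_uminus[OF K \<iota>])
  then show "dop_apply (map_dop \<iota> (schrodinger u - dop_const l)) z = \<iota> (u - l) * z - der (der z)"
    and "dop_order (map_dop \<iota> (schrodinger u - dop_const l)) = 2"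
    by (simp_all add: dop_apply_Dop dop_order_Dop numeral_2_eq_2)
qed


section \<open>Constants of a constrained extension\<close>

lemma differential_subfield_sum:
  assumes "differential_subfield F" "\<And>i. i \<in> I \<Longrightarrow> f i \<in> F"
  shows "sum f I \<in> F"
  using assms(2)
  by (induction I rule: infinite_finite_induct)
    (simp_all add: differential_subfield_closed[OF assms(1)])

lemma der_poly_constant:
  assumes "der c = 0"
  shows "der (poly p c) = poly (map_poly der p) c"
  by (induction p) (simp_all add: map_poly_pCons der_add der_mult assms)

text \<open>
  Normalize an annihilating polynomial to be monic and differentiate its coefficients: the result has
  lower degree and still vanishes at the constant \<open>c\<close>. So either the degree can be lowered, or all
  coefficients are constants; in that case the polynomial has a root \<open>r\<close> in the base field, and
  unless \<open>c = r\<close> the factor \<open>X - r\<close> can be split off.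
\<close>

lemma constant_algebraic_in_subfield:
  fixes k :: "'u::differential_field set"
  assumes k: "differential_subfield k" and closed: "algebraically_closed (k \<inter> constants)"
    and c: "der c = 0" and p: "p \<noteq> 0" "\<And>i. coeff p i \<in> k" "poly p c = 0"
  shows "c \<in> k"
  using p
proof (induction "degree p" arbitrary: p rule: less_induct)
  case less
  note cl = differential_subfield_closed[OF k]
  define q where "q = smult (inverse (lead_coeff p)) p"
  have q: "q \<noteq> 0" "\<And>i. coeff q i \<in> k" "poly q c = 0" "degree q = degree p" "lead_coeff q = 1"
    using less.prems cl by (auto simp: q_def)
  have pos: "degree q > 0"
    using q(1,3) by (cases "degree q = 0") (auto elim: degree_eq_zeroE)
  show ?case
  proof (cases "map_poly der q = 0")
    case False
    have "coeff (map_poly der q) n = 0" if "n \<ge> degree q" for n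
      using that q(5) by (cases "n = degree q") (auto simp: coeff_map_poly coeff_eq_0)
    then have "degree (map_poly der q) < degree q"
      using False pos by (metis leading_coeff_neq_0 not_le)
    moreover have "poly (map_poly der q) c = 0"
      using der_poly_constant[OF c, of q] q(3) by simp
    ultimately show ?thesis
      using less.hyps[of "map_poly der q"] False q cl by (simp add: coeff_map_poly)
  next
    case True
    have "der (coeff q i) = 0" for i
      using arg_cong[OF True, of "\<lambda>p. coeff p i"] by (simp add: coeff_map_poly)
    then have "\<forall>i. coeff q i \<in> k \<inter> constants" using q by (simp add: constants_def)
    then obtain r where r: "r \<in> k" "poly q r = 0"
      using closed pos unfolding algebraically_closed_def by blast
    have split: "q = [:- r, 1:] * synthetic_div q r"
      using synthetic_div_correct'[of r q] r by simp
    have coeffs: "\<And>i. coeff f i \<in> k \<Longrightarrow> coeff (synthetic_div f r) i \<in> k" if "\<And>i. coeff f i \<in> k" for f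
      using that
    proof (induction f)
      case (pCons a f)
      have "coeff f i \<in> k" for i using pCons.prems(2)[of "Suc i"] by simp
      then show ?case
        using pCons.IH differential_subfield_poly[OF k _ r(1), of f]
        by (simp add: coeff_pCons split: nat.split)
    qed (simp add: cl)
    show ?thesis
    proof (cases "c = r")
      case False
      have "poly q c = (c - r) * poly (synthetic_div q r) c" by (subst split) (simp add: algebra_simps)
      then have "poly (synthetic_div q r) c = 0" using False q(3) by simp
      moreover have "synthetic_div q r \<noteq> 0" using split q(1) by auto
      moreover have "degree (synthetic_div q r) < degree p"
        using pos q(4) by (simp add: degree_synthetic_div)
      ultimately show ?thesis using less.hyps coeffs q(2) by blast
    qed (use r in simp)
  qed
qed

lemma mpoly_eval_superset:
  assumes "finite S" "Poly_Mapping.keys f \<subseteq> S"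
  shows "mpoly_eval x f = (\<Sum>m\<in>S. Poly_Mapping.lookup f m *
    (\<Prod>v\<in>Poly_Mapping.keys m. x v ^ Poly_Mapping.lookup m v))"
  unfolding mpoly_eval_def
  by (rule sum.mono_neutral_left) (use assms in \<open>auto simp: in_keys_iff\<close>)

lemma mpoly_eval_add: "mpoly_eval x (f + g) = mpoly_eval x f + mpoly_eval x g"
proof -
  let ?S = "Poly_Mapping.keys f \<union> Poly_Mapping.keys g"
  have "Poly_Mapping.keys (f + g) \<subseteq> ?S" by (rule Poly_Mapping.keys_add)
  then show ?thesis
    by (simp add: mpoly_eval_superset[of ?S] lookup_add distrib_right sum.distrib)
qed

lemma mpoly_eval_single:
  "mpoly_eval x (Poly_Mapping.single m a)
    = a * (\<Prod>v\<in>Poly_Mapping.keys m. x v ^ Poly_Mapping.lookup m v)"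
  by (simp add: mpoly_eval_superset[of "{m}"])

text \<open>
  All derivatives of a constant vanish, so on constants a differential polynomial is an ordinary
  polynomial in one variable.
\<close>

lemma mpoly_eval_constant_jets:
  fixes k :: "'u::differential_field set"
  assumes k: "differential_subfield k" and f: "f \<in> dpolys k n"
  obtains p where "\<And>i. coeff p i \<in> k"
    "\<And>z. z \<in> constants \<Longrightarrow> mpoly_eval (jets (\<lambda>_. z)) f = poly p z"
proof
  note cl = differential_subfield_closed[OF k]
  let ?S = "{p. \<forall>i. coeff p i \<in> k}"
  let ?x = "\<lambda>v :: nat \<times> nat. if snd v = 0 then [:0, 1 :: 'u:] else 0"
  let ?g = "\<lambda>m. [:Poly_Mapping.lookup f m:] *
    (\<Prod>v\<in>Poly_Mapping.keys m. ?x v ^ Poly_Mapping.lookup m v)"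
  have add: "p + q \<in> ?S" and mult: "p * q \<in> ?S" if "p \<in> ?S" "q \<in> ?S" for p q
    using that by (auto simp: cl coeff_mult intro!: differential_subfield_sum[OF k])
  have one: "1 \<in> ?S" by (auto simp: one_pCons coeff_pCons cl split: nat.split)
  have pow: "p ^ n \<in> ?S" if "p \<in> ?S" for p n
    by (induction n) (use one mult that in \<open>simp_all only: power.simps\<close>)
  have prod: "prod h I \<in> ?S" if "\<And>i. h i \<in> ?S" for h and I :: "(nat \<times> nat) set"
    by (induction I rule: infinite_finite_induct)
      (use one mult that in \<open>simp_all del: mem_Collect_eq\<close>)
  have x: "?x v \<in> ?S" for v by (auto simp: coeff_pCons cl split: nat.split)
  have "[:Poly_Mapping.lookup f m:] \<in> ?S" for m
    using f by (auto simp: dpolys_def coeff_pCons cl split: nat.split)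
  then have "?g m \<in> ?S" for m by (intro mult prod pow x)
  then have "sum ?g I \<in> ?S" for I
    by (auto simp only: coeff_sum mem_Collect_eq intro!: differential_subfield_sum[OF k])
  then show "coeff (sum ?g (Poly_Mapping.keys f)) i \<in> k" for i by blast
next
  fix z :: 'u assume "z \<in> constants"
  then have "(der ^^ i) z = (if i = 0 then z else 0)" for i
    by (induction i) (auto simp: constants_def)
  then have "jets (\<lambda>_. z) v = poly (if snd v = 0 then [:0, 1:] else 0) z" for v
    by (cases v) (simp add: jets_def jet_def)
  then show "mpoly_eval (jets (\<lambda>_. z)) f = poly (\<Sum>m\<in>Poly_Mapping.keys f.
      [:Poly_Mapping.lookup f m:] * (\<Prod>v\<in>Poly_Mapping.keys m.
        (if snd v = 0 then [:0, 1:] else 0) ^ Poly_Mapping.lookup m v)) z"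
    by (simp add: mpoly_eval_def poly_sum poly_prod poly_power)
qed

text \<open>
  A constant \<open>c\<close> outside \<open>k\<close> is transcendental over \<open>k\<close>, so every constant \<open>\<zeta>\<close> of \<open>k\<close> is a
  specialization of \<open>c\<close>. A constraint \<open>B\<close> excludes only the roots of a nonzero polynomial, so some
  natural number \<open>\<zeta>\<close> is left over. It would have to be generic, but it satisfies \<open>y - \<zeta> = 0\<close> while
  \<open>c\<close> does not.
\<close>

lemma constrained_constant_in_subfield:
  fixes k :: "'u::differential_field set"
  assumes k: "differential_subfield k" and closed: "algebraically_closed (k \<inter> constants)"
    and c: "c \<in> constants" and con: "constrained k 1 (\<lambda>_. c)"
  shows "c \<in> k"
proof (rule ccontr)
  assume "c \<notin> k"
  note cl = differential_subfield_closed[OF k]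
  have transcendental: "p = 0" if "\<And>i. coeff p i \<in> k" "poly p c = 0" for p
    using constant_algebraic_in_subfield[OF k closed, of c p] c that \<open>c \<notin> k\<close>
    by (auto simp: constants_def)
  obtain B where B: "B \<in> dpolys k 1" "mpoly_eval (jets (\<lambda>_. c)) B \<noteq> 0"
    and generic: "\<And>\<zeta> f. mpoly_eval (jets \<zeta>) B \<noteq> 0 \<Longrightarrow>
      (\<forall>f\<in>dpolys k 1. mpoly_eval (jets (\<lambda>_. c)) f = 0 \<longrightarrow> mpoly_eval (jets \<zeta>) f = 0) \<Longrightarrow>
      f \<in> dpolys k 1 \<Longrightarrow> mpoly_eval (jets \<zeta>) f = 0 \<Longrightarrow> mpoly_eval (jets (\<lambda>_. c)) f = 0"
    using con unfolding constrained_def by blast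
  obtain b where b: "\<And>i. coeff b i \<in> k"
    "\<And>z. z \<in> constants \<Longrightarrow> mpoly_eval (jets (\<lambda>_. z)) B = poly b z"
    using mpoly_eval_constant_jets[OF k B(1)] by blast
  have "b \<noteq> 0" using b(2)[OF c] B(2) by auto
  then have "\<not> range of_nat \<subseteq> {z. poly b z = 0}"
    using poly_roots_finite[of b] finite_subset range_inj_infinite[OF inj_of_nat] by blast
  then obtain n where n: "poly b (of_nat n) \<noteq> 0" by blast
  define \<zeta> :: 'u where "\<zeta> = of_nat n"
  have \<zeta>: "\<zeta> \<in> k" "\<zeta> \<in> constants"
    unfolding \<zeta>_def constants_def by (induction n) (simp_all add: cl der_add)
  define f :: "(nat \<times> nat \<Rightarrow>\<^sub>0 nat) \<Rightarrow>\<^sub>0 'u" where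
    "f = Poly_Mapping.single (Poly_Mapping.single (0, 0) 1) 1 + Poly_Mapping.single 0 (- \<zeta>)"
  have eval_f: "mpoly_eval (jets (\<lambda>_. z)) f = z - \<zeta>" for z
    by (simp add: f_def mpoly_eval_add mpoly_eval_single jets_def jet_def)
  have "Poly_Mapping.keys f \<subseteq> {Poly_Mapping.single (0, 0) 1, 0}"
    unfolding f_def by (rule order_trans[OF Poly_Mapping.keys_add]) auto
  then have "mpoly_vars f \<subseteq> {..<1} \<times> UNIV"
    by (fastforce simp: mpoly_vars_def)
  moreover have "Poly_Mapping.lookup f m \<in> k" for m
    using \<zeta> cl by (simp add: f_def lookup_add lookup_single when_def)
  ultimately have "f \<in> dpolys k 1" by (simp add: dpolys_def)
  moreover have "mpoly_eval (jets (\<lambda>_. \<zeta>)) g = 0"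
    if g: "g \<in> dpolys k 1" "mpoly_eval (jets (\<lambda>_. c)) g = 0" for g
  proof -
    obtain p where p: "\<And>i. coeff p i \<in> k"
      "\<And>z. z \<in> constants \<Longrightarrow> mpoly_eval (jets (\<lambda>_. z)) g = poly p z"
      using mpoly_eval_constant_jets[OF k g(1)] by blast
    have "p = 0" using transcendental[OF p(1)] p(2)[OF c] g(2) by simp
    then show ?thesis using p(2)[OF \<zeta>(2)] by simp
  qed
  ultimately have "mpoly_eval (jets (\<lambda>_. c)) f = 0"
    using generic[of "\<lambda>_. \<zeta>" f] b(2)[OF \<zeta>(2)] n eval_f[of \<zeta>] by (simp add: \<zeta>_def)
  then show False using eval_f[of c] \<zeta> \<open>c \<notin> k\<close> by simp
qed

text \<open>
  Blum's axiom for \<open>f = y' - \<phi> y\<close>, of order one, and \<open>g = y\<close>, of order zero.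
\<close>

lemma differentially_closed_first_order:
  fixes \<phi> :: "'u::differential_field"
  assumes "differentially_closed TYPE('u)"
  obtains y where "y \<noteq> 0" "der y = \<phi> * (y :: 'u)"
proof -
  define f :: "(nat \<Rightarrow>\<^sub>0 nat) \<Rightarrow>\<^sub>0 'u" where
    "f = Poly_Mapping.single (Poly_Mapping.single 1 1) 1
       + Poly_Mapping.single (Poly_Mapping.single 0 1) (- \<phi>)"
  define g :: "(nat \<Rightarrow>\<^sub>0 nat) \<Rightarrow>\<^sub>0 'u" where
    "g = Poly_Mapping.single (Poly_Mapping.single 0 1) 1"
  have ne: "Poly_Mapping.single (0::nat) (1::nat) \<noteq> Poly_Mapping.single 1 1"
    by (metis lookup_single_eq lookup_single_not_eq zero_neq_one)
  then have "Poly_Mapping.lookup f (Poly_Mapping.single 1 1) = 1"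
    by (simp add: f_def lookup_add lookup_single_not_eq)
  then have "Poly_Mapping.single 1 1 \<in> Poly_Mapping.keys f" by (simp add: in_keys_iff)
  then have "1 \<in> mpoly_vars f" by (force simp: mpoly_vars_def)
  moreover have "\<forall>i\<in>mpoly_vars g. i < 1" by (simp add: mpoly_vars_def g_def)
  moreover have "g \<noteq> 0" by (metis g_def lookup_single_eq lookup_zero zero_neq_one)
  ultimately obtain y where "mpoly_eval (jet y) f = 0" "mpoly_eval (jet y) g \<noteq> 0"
    using assms unfolding differentially_closed_def by metis
  then show thesis
    using that[of y] by (simp add: f_def g_def mpoly_eval_add mpoly_eval_single jet_def)
qed

section \<open>The Picard-Vessiot extension of an algebro-geometric Schroedinger operator\<close>

theorem theorem5p3:
  fixes u l\<^sub>0 \<mu>\<^sub>0 \<phi>\<^sub>0 :: "'a::differential_field"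
    and s :: nat and A :: "'a dop" and R :: "'a poly"
    and \<iota> :: "'a \<Rightarrow> 'u::differential_field"
  assumes "algebraically_closed (constants :: 'a set)"
    and "u \<notin> constants"
    and "algebro_geometric (schrodinger u)"
    and "is_partner (schrodinger u) s A R"
    and "(l\<^sub>0, \<mu>\<^sub>0) \<in> spectral_curve R - spectral_zeros R"
    and "is_gcrd_over (potential_field u) (\<partial> - dop_const \<phi>\<^sub>0)
           (schrodinger u - dop_const l\<^sub>0) (A - dop_const \<mu>\<^sub>0)"
    and "differential_closure (potential_field u) \<iota>"
  shows "(\<exists>y\<^sub>0. y\<^sub>0 \<noteq> 0 \<and> dop_apply (map_dop \<iota> (\<partial> - dop_const \<phi>\<^sub>0)) y\<^sub>0 = 0) \<and>
    (\<forall>y\<^sub>0. y\<^sub>0 \<noteq> 0 \<and> dop_apply (map_dop \<iota> (\<partial> - dop_const \<phi>\<^sub>0)) y\<^sub>0 = 0 \<longrightarrow>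
       liouvillian (\<iota> ` potential_field u) (diff_adjoin (\<iota> ` potential_field u) {y\<^sub>0}) \<and>
       (\<forall>F. picard_vessiot (\<iota> ` potential_field u)
              (map_dop \<iota> (schrodinger u - dop_const l\<^sub>0)) F \<longleftrightarrow>
            F = diff_adjoin (\<iota> ` potential_field u) {y\<^sub>0}))"
proof -
  define K where "K = potential_field u"
  define k where "k = \<iota> ` K"
  have K: "differential_subfield K"
    unfolding K_def potential_field_def by (rule differential_subfield_diff_adjoin)
  have C: "constants \<subseteq> K" and u: "u \<in> K"
    unfolding K_def potential_field_def using diff_adjoin_base diff_adjoin_gens by blast+
  have \<iota>: "differential_embedding K \<iota>" and dc: "differentially_closed TYPE('u)"
    and con: "constrained k n \<eta>" for n \<eta>
    using assms(7) by (auto simp: differential_closure_def K_def k_def)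
  have l: "l\<^sub>0 \<in> constants" and m: "\<mu>\<^sub>0 \<in> constants" "\<mu>\<^sub>0 \<noteq> 0" and curve: "\<mu>\<^sub>0 ^ 2 + poly R l\<^sub>0 = 0"
    using assms(5) by (auto simp: spectral_curve_def spectral_zeros_def)
  obtain a where a: "\<phi>\<^sub>0 \<in> K" "u - l\<^sub>0 = der \<phi>\<^sub>0 + \<phi>\<^sub>0\<^sup>2" "a \<in> K" "a \<noteq> 0"
    "der a = 2 * a * \<phi>\<^sub>0 - 2 * \<mu>\<^sub>0"
    using partner_remainder[OF K l m(1) u C assms(4) curve assms(6)[folded K_def]] .
  note cl = differential_subfield_closed[OF K]
  note \<iota>_simps = embedding_add[OF K \<iota>] embedding_mult[OF K \<iota>] embedding_der[OF K \<iota>]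
    embedding_diff[OF K \<iota>]
  have k: "differential_subfield k"
    unfolding k_def by (rule differential_subfield_embedding_image[OF K \<iota>])
  have mK: "\<mu>\<^sub>0 \<in> K" and vK: "u - l\<^sub>0 \<in> K" using m l u C cl by auto
  have Ck: "constants \<subseteq> k"
    using constrained_constant_in_subfield[OF k _ _ con]
      embedding_algebraically_closed[OF K \<iota> C assms(1)] embedding_image_constants[OF K \<iota> C]
    unfolding k_def by auto
  have v: "\<iota> (u - l\<^sub>0) = der (\<iota> \<phi>\<^sub>0) + (\<iota> \<phi>\<^sub>0)\<^sup>2"
    using a(1) cl by (simp add: a(2) power2_eq_square \<iota>_simps)
  have der_a: "der (\<iota> a) = 2 * \<iota> a * \<iota> \<phi>\<^sub>0 - 2 * \<iota> \<mu>\<^sub>0"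
  proof -
    \<comment> \<open>written without the numeral \<open>2\<close>, on which \<open>\<iota>\<close> would have to be evaluated\<close>
    have "der a = (a * \<phi>\<^sub>0 + a * \<phi>\<^sub>0) - (\<mu>\<^sub>0 + \<mu>\<^sub>0)" using a(5) by simp
    then have "der (\<iota> a) = \<iota> (a * \<phi>\<^sub>0 + a * \<phi>\<^sub>0 - (\<mu>\<^sub>0 + \<mu>\<^sub>0))"
      using embedding_der[OF K \<iota> a(3)] by (simp only:)
    also have "\<dots> = \<iota> a * \<iota> \<phi>\<^sub>0 + \<iota> a * \<iota> \<phi>\<^sub>0 - (\<iota> \<mu>\<^sub>0 + \<iota> \<mu>\<^sub>0)"
      by (simp only: \<iota>_simps a(1,3) mK cl)
    finally show ?thesis by simp
  qed
  have m\<iota>: "\<iota> \<mu>\<^sub>0 \<in> constants" "\<iota> \<mu>\<^sub>0 \<noteq> 0"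
    using m embedding_image_constants[OF K \<iota> C] embedding_eq_0[OF K \<iota> mK] by auto
  have a\<iota>: "\<iota> a \<in> k" "\<iota> a \<noteq> 0"
    using a embedding_eq_0[OF K \<iota>] by (auto simp: k_def)
  have sol: "dop_apply (map_dop \<iota> (\<partial> - dop_const \<phi>\<^sub>0)) y = 0 \<longleftrightarrow> der y = \<iota> \<phi>\<^sub>0 * y" for y
    by (simp add: dop_apply_map_first_order[OF K \<iota> a(1)])
  let ?M = "map_dop \<iota> (schrodinger u - dop_const l\<^sub>0)"
  have V: "dop_apply ?M z = 0 \<longleftrightarrow> der (der z) = \<iota> (u - l\<^sub>0) * z" for z
    by (auto simp: map_dop_schrodinger[OF K \<iota> vK])
  have "liouvillian k (diff_adjoin k {y})" if "y \<noteq> 0" "der y = \<iota> \<phi>\<^sub>0 * y" for y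
    by (rule liouvillian.exponential[OF liouvillian.base[OF k]])
      (use that a(1) in \<open>auto simp: k_def\<close>)
  moreover have "picard_vessiot k ?M F \<longleftrightarrow> F = diff_adjoin k {y}"
    if "y \<noteq> 0" "der y = \<iota> \<phi>\<^sub>0 * y" for y F
    by (rule picard_vessiot_iff_exponential[OF k Ck V map_dop_schrodinger(2)[OF K \<iota> vK] v
      a\<iota> der_a m\<iota> that])
  moreover obtain y where "y \<noteq> 0" "der y = \<iota> \<phi>\<^sub>0 * y"
    using differentially_closed_first_order[OF dc] .
  ultimately show ?thesis unfolding sol K_def[symmetric] k_def[symmetric] by blast
qed

end
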